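(* Let $G$ be a finite group and $H$ a subgroup of index $2$ and order $n$. Let $S_1,S_2\subset G\setminus H$ with $S_1\cup S_2=G\setminus H$, $S_1\cap S_2=\emptyset$, $|S_1|=k$, $|S_2|=n-k$, where $0<k<n$. Then: (i) if $\mathcal{G}(G,H,S_1)$ is not connected, then for each $\mu\in\{k,-k\}$ there are linearly independent eigenfunctions $f$ and $g$ of $\mathcal{G}(G,H,S_1)$ with eigenvalue $\mu$ such that $f-g$ is an eigenfunction of $\mathcal{G}(G,H,S_2)$ with eigenvalue $-\mu$; (ii) if $f$ is an eigenfunction of $\mathcal{G}(G,H,S_1)$ with eigenvalue $\mu\neq\pm k$, then $f$ is an eigenfunction of $\mathcal{G}(G,H,S_2)$ with eigenvalue $-\mu$.
   Context: The group-subgroup pair graph $\mathcal{G}(G,H,S)$ (for $S\subset G\setminus H$) is the undirected graph with vertex set $G$ whose edges are exactly the pairs $\{h,hs\}$ with $h\in H$, $s\in S$. An eigenfunction with eigenvalue $\mu$ is a nonzero $f:G\to\mathbb{C}$ with $Af=\mu f$, where $A$ is the adjacency operator: $(Af)(y)=\sum_{s\in S}f(ys)$ for $y\in H$ and $(Af)(y)=\sum_{s\in S}f(ys^{-1})$ for $y\in G\setminus H$. *)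

theory Defs
  imports Complex_Main "HOL-Algebra.Coset" "Graph_Theory.Graph_Theory"
begin

(* The undirected edge {h, hs} is encoded by the two arcs (h, hs) and (hs, h). *)
definition pair_graph_of ::
  "('a, 'm) monoid_scheme \<Rightarrow> 'a set \<Rightarrow> 'a set \<Rightarrow> 'a pair_pre_digraph" where
  "pair_graph_of G H S =
     \<lparr> pverts = carrier G,
       parcs = (\<Union>h\<in>H. \<Union>s\<in>S. {(h, h \<otimes>\<^bsub>G\<^esub> s), (h \<otimes>\<^bsub>G\<^esub> s, h)}) \<rparr>"

definition adj_op ::
  "('a, 'm) monoid_scheme \<Rightarrow> 'a set \<Rightarrow> 'a set \<Rightarrow> ('a \<Rightarrow> complex) \<Rightarrow> 'a \<Rightarrow> complex" where
  "adj_op G H S f y =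
     (if y \<in> H then \<Sum>s\<in>S. f (y \<otimes>\<^bsub>G\<^esub> s) else \<Sum>s\<in>S. f (y \<otimes>\<^bsub>G\<^esub> inv\<^bsub>G\<^esub> s))"

(* A function on the group is represented by a total function of which only the values on
   the carrier matter; hence "nonzero" and all identities below are relative to the carrier. *)
definition eigenfunction ::
  "('a, 'm) monoid_scheme \<Rightarrow> 'a set \<Rightarrow> 'a set \<Rightarrow> complex \<Rightarrow> ('a \<Rightarrow> complex) \<Rightarrow> bool" where
  "eigenfunction G H S \<mu> f \<longleftrightarrow>
     (\<exists>x\<in>carrier G. f x \<noteq> 0) \<and> (\<forall>y\<in>carrier G. adj_op G H S f y = \<mu> * f y)"

definition lin_indep_pair_on :: "'a set \<Rightarrow> ('a \<Rightarrow> complex) \<Rightarrow> ('a \<Rightarrow> complex) \<Rightarrow> bool" where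
  "lin_indep_pair_on X f g \<longleftrightarrow>
     (\<forall>a b :: complex. (\<forall>x\<in>X. a * f x + b * g x = 0) \<longrightarrow> a = 0 \<and> b = 0)"

end

theory Submission
  imports Defs
begin

text \<open>
  Write \<open>C = G - H\<close>. Since \<open>S1\<close> and \<open>S2\<close> partition \<open>C\<close>, the two adjacency operators add up to that
  of the complete bipartite graph on \<open>H\<close> and \<open>C\<close>, which annihilates every function whose sums over
  \<open>H\<close> and over \<open>C\<close> both vanish; such eigenfunctions therefore pass from \<open>S1\<close> to \<open>S2\<close> with the
  eigenvalue negated. Summing \<open>A f = \<mu> f\<close> over \<open>H\<close> and over \<open>C\<close> shows that both sums vanish unless
  \<open>\<mu> = \<plusminus>k\<close>. For \<open>\<mu> = \<plusminus>k\<close> and a disconnected graph, a union of components \<open>W\<close> and its complement,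
  normalised to mass 1 on \<open>H\<close> (and with a sign change on \<open>C\<close> when \<open>\<mu> = -k\<close>), are the required \<open>f\<close>
  and \<open>g\<close>.
\<close>

text \<open>At a point of \<open>W\<close> only the \<open>f\<close> term of a combination survives,
  at a point outside \<open>W\<close> only the \<open>g\<close> term.\<close>

lemma lin_indep_pair_on_disjoint_support:
  assumes "\<And>x. x \<in> X \<Longrightarrow> f x \<noteq> 0 \<longleftrightarrow> x \<in> W" "\<And>x. x \<in> X \<Longrightarrow> g x \<noteq> 0 \<longleftrightarrow> x \<in> - W"
    and "X \<inter> W \<noteq> {}" "X - W \<noteq> {}"
  shows "lin_indep_pair_on X f g"
  unfolding lin_indep_pair_on_def
proof (intro allI impI)
  fix a b :: complex
  assume eq: "\<forall>x\<in>X. a * f x + b * g x = 0"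
  obtain x y where "x \<in> X" "x \<in> W" "y \<in> X" "y \<notin> W"
    using assms(3,4) by blast
  thus "a = 0 \<and> b = 0"
    using assms(1,2)[of x] assms(1,2)[of y] eq[rule_format, of x] eq[rule_format, of y] by auto
qed

text \<open>Linearity gives the eigenvalue equation; independence, with coefficients
  \<open>1\<close> and \<open>- 1\<close>, keeps the difference from vanishing on the
  carrier.\<close>

lemma eigenfunction_diff:
  assumes "eigenfunction G H S \<mu> f" "eigenfunction G H S \<mu> g"
    and "lin_indep_pair_on (carrier G) f g"
  shows "eigenfunction G H S \<mu> (\<lambda>x. f x - g x)"
proof -
  have "\<exists>x\<in>carrier G. f x - g x \<noteq> 0"
    using assms(3)[unfolded lin_indep_pair_on_def, rule_format, of 1 "- 1"] by auto
  moreover have "adj_op G H S (\<lambda>x. f x - g x) y = adj_op G H S f y - adj_op G H S g y" for y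
    by (simp add: adj_op_def sum_subtractf)
  ultimately show ?thesis
    using assms(1,2) by (simp add: eigenfunction_def right_diff_distrib)
qed

section \<open>Translations between the two cosets of \<open>H\<close>\<close>

locale index_two = group G + subgroup H G for G (structure) and H +
  assumes finite_carrier: "finite (carrier G)"
    and index: "card (rcosets H) = 2"
begin

abbreviation odd_part (\<open>C\<close>) where "C \<equiv> carrier G - H"

lemma finite_H: "finite H"
  using finite_carrier subset finite_subset by blast

lemma finite_C: "finite C"
  using finite_carrier by simp

lemma card_C: "card C = card H"
proof -
  have "2 * card H = card (carrier G)"
    using lagrange_finite[OF finite_carrier subgroup_axioms] index by (simp add: order_def)
  thus ?thesis
    using card_Diff_subset[OF finite_H subset] by simp
qed

lemma mult_in_C:
  assumes "h \<in> H" "s \<in> C"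
  shows "h \<otimes> s \<in> C"
proof -
  have "s \<in> H" if "h \<otimes> s \<in> H"
  proof -
    have "inv h \<otimes> (h \<otimes> s) \<in> H"
      using that assms by simp
    thus ?thesis
      using assms mem_carrier by (simp add: m_assoc[symmetric])
  qed
  thus ?thesis
    using assms mem_carrier by auto
qed

text \<open>Cancellation makes the translation injective; it is onto because index two gives both
  cosets the same size.\<close>

lemma bij_betw_H_C:
  assumes "s \<in> C"
  shows "bij_betw (\<lambda>h. h \<otimes> s) H C"
proof -
  have inj: "inj_on (\<lambda>h. h \<otimes> s) H"
    using assms mem_carrier by (auto intro!: inj_onI)
  have "(\<lambda>h. h \<otimes> s) ` H = C"
    using assms mult_in_C card_C by (intro card_subset_eq finite_C) (auto simp: card_image[OF inj])
  with inj show ?thesis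
    by (simp add: bij_betw_def)
qed

lemma mult_inv_in_H:
  assumes "y \<in> C" "s \<in> C"
  shows "y \<otimes> inv s \<in> H"
proof -
  obtain h where "h \<in> H" "y = h \<otimes> s"
    using bij_betw_H_C[OF assms(2)] assms(1) by (auto simp: bij_betw_def)
  thus ?thesis
    using assms mem_carrier by (simp add: m_assoc)
qed

lemma bij_betw_C_H:
  assumes "s \<in> C"
  shows "bij_betw (\<lambda>y. y \<otimes> inv s) C H"
  using assms mem_carrier mult_in_C mult_inv_in_H
  by (intro bij_betw_byWitness[where f' = "\<lambda>h. h \<otimes> s"]) (auto simp: m_assoc)

lemma bij_betw_C_C:
  assumes "h \<in> H"
  shows "bij_betw (\<lambda>s. h \<otimes> s) C C"
  using assms mem_carrier mult_in_C
  by (intro bij_betw_byWitness[where f' = "\<lambda>s. inv h \<otimes> s"]) (auto simp: m_assoc[symmetric])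

lemma bij_betw_C_H_inv:
  assumes "y \<in> C"
  shows "bij_betw (\<lambda>s. y \<otimes> inv s) C H"
proof -
  have inj: "inj_on (\<lambda>s. y \<otimes> inv s) C"
    using assms by (auto intro!: inj_onI dest: inj_onD[OF inv_inj])
  have "(\<lambda>s. y \<otimes> inv s) ` C = H"
    using assms mult_inv_in_H card_C by (intro card_subset_eq finite_H) (auto simp: card_image[OF inj])
  with inj show ?thesis
    by (simp add: bij_betw_def)
qed

section \<open>The adjacency operator and sums over the two cosets\<close>

lemma adj_op_C:
  assumes "y \<in> carrier G"
  shows "adj_op G H C f y = (if y \<in> H then \<Sum>x\<in>C. f x else \<Sum>x\<in>H. f x)"
  using assms sum.reindex_bij_betw[OF bij_betw_C_C, of y f]
    sum.reindex_bij_betw[OF bij_betw_C_H_inv, of y f]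
  by (simp add: adj_op_def)

lemma adj_op_Un:
  assumes "S1 \<subseteq> C" "S2 \<subseteq> C" "S1 \<inter> S2 = {}"
  shows "adj_op G H (S1 \<union> S2) f y = adj_op G H S1 f y + adj_op G H S2 f y"
  using assms finite_subset[OF _ finite_C] by (simp add: adj_op_def sum.union_disjoint)

text \<open>After exchanging the sums, each \<open>s\<close> contributes a full sum over
  \<open>C\<close>, since translation by \<open>s\<close> carries \<open>H\<close> bijectively to
  \<open>C\<close>.\<close>

lemma sum_adj_op_H:
  assumes "S \<subseteq> C"
  shows "(\<Sum>y\<in>H. adj_op G H S f y) = of_nat (card S) * (\<Sum>x\<in>C. f x)"
proof -
  have "(\<Sum>y\<in>H. adj_op G H S f y) = (\<Sum>s\<in>S. \<Sum>y\<in>H. f (y \<otimes> s))"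
    by (simp add: adj_op_def sum.swap[of _ H])
  also have "\<dots> = (\<Sum>s\<in>S. \<Sum>x\<in>C. f x)"
    using assms by (intro sum.cong refl sum.reindex_bij_betw bij_betw_H_C) auto
  finally show ?thesis by simp
qed

lemma sum_adj_op_C:
  assumes "S \<subseteq> C"
  shows "(\<Sum>y\<in>C. adj_op G H S f y) = of_nat (card S) * (\<Sum>x\<in>H. f x)"
proof -
  have "(\<Sum>y\<in>C. adj_op G H S f y) = (\<Sum>s\<in>S. \<Sum>y\<in>C. f (y \<otimes> inv s))"
    by (simp add: adj_op_def sum.swap[of _ C])
  also have "\<dots> = (\<Sum>s\<in>S. \<Sum>x\<in>H. f x)"
    using assms by (intro sum.cong refl sum.reindex_bij_betw bij_betw_C_H) auto
  finally show ?thesis by simp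
qed

lemma eigenfunction_sums:
  assumes "S \<subseteq> C" "eigenfunction G H S \<mu> f"
  shows "of_nat (card S) * (\<Sum>x\<in>C. f x) = \<mu> * (\<Sum>x\<in>H. f x)"
    and "of_nat (card S) * (\<Sum>x\<in>H. f x) = \<mu> * (\<Sum>x\<in>C. f x)"
proof -
  have eig: "adj_op G H S f y = \<mu> * f y" if "y \<in> carrier G" for y
    using assms(2) that by (simp add: eigenfunction_def)
  show "of_nat (card S) * (\<Sum>x\<in>C. f x) = \<mu> * (\<Sum>x\<in>H. f x)"
    using sum_adj_op_H[OF assms(1), of f] eig mem_carrier by (simp add: sum_distrib_left)
  show "of_nat (card S) * (\<Sum>x\<in>H. f x) = \<mu> * (\<Sum>x\<in>C. f x)"
    using sum_adj_op_C[OF assms(1), of f] eig by (simp add: sum_distrib_left)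
qed

text \<open>With k = \<open>card S\<close>, the sums a over \<open>H\<close> and b over
  \<open>C\<close> satisfy k b = \<mu> a and k a = \<mu> b. Hence \<mu> \<mu> a and k k a both equal
  k \<mu> b, which forces a = 0; then b = 0 because k > 0.\<close>

lemma eigenfunction_sums_zero:
  assumes "S \<subseteq> C" "eigenfunction G H S \<mu> f" "card S > 0"
    and "\<mu> \<noteq> of_nat (card S)" "\<mu> \<noteq> - of_nat (card S)"
  shows "(\<Sum>x\<in>H. f x) = 0" "(\<Sum>x\<in>C. f x) = 0"
proof -
  let ?k = "of_nat (card S) :: complex" and ?a = "\<Sum>x\<in>H. f x" and ?b = "\<Sum>x\<in>C. f x"
  note sums = eigenfunction_sums[OF assms(1,2)]
  have "(\<mu> - ?k) * (\<mu> + ?k) * ?a = \<mu> * (\<mu> * ?a) - ?k * (?k * ?a)"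
    by (simp add: algebra_simps)
  also have "\<dots> = 0"
    unfolding sums(1)[symmetric] sums(2) by (simp add: algebra_simps)
  finally show a: "?a = 0"
    using assms(4,5) by (simp add: add_eq_0_iff2)
  show "?b = 0"
    using sums(1) assms(3) unfolding a by auto
qed

lemma eigenfunction_complement:
  assumes "S1 \<subseteq> C" "S2 \<subseteq> C" "S1 \<union> S2 = C" "S1 \<inter> S2 = {}"
    and "eigenfunction G H S1 \<mu> f" "(\<Sum>x\<in>H. f x) = 0" "(\<Sum>x\<in>C. f x) = 0"
  shows "eigenfunction G H S2 (- \<mu>) f"
proof -
  have "adj_op G H S2 f y = - \<mu> * f y" if y: "y \<in> carrier G" for y
  proof -
    have "adj_op G H S1 f y + adj_op G H S2 f y = 0"
      using adj_op_Un[OF assms(1,2,4), of f y] adj_op_C[OF y, of f]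
      by (simp add: assms(3,6,7) split: if_splits)
    moreover have "adj_op G H S1 f y = \<mu> * f y"
      using assms(5) y by (simp add: eigenfunction_def)
    ultimately show ?thesis
      by (simp add: add_eq_0_iff)
  qed
  thus ?thesis
    using assms(5) by (simp add: eigenfunction_def)
qed

section \<open>Eigenfunctions from vertex sets closed along edges\<close>

definition twist :: "complex \<Rightarrow> ('a \<Rightarrow> complex) \<Rightarrow> 'a \<Rightarrow> complex" where
  "twist c \<phi> x = (if x \<in> H then \<phi> x else c * \<phi> x)"

text \<open>Since \<open>\<phi>\<close> is constant along edges, the operator only counts neighbours
  and moves the factor \<open>c\<close> across the bipartition. For \<open>y\<close> outside
  \<open>H\<close> the factor is lost, and \<open>c * c = 1\<close> restores it.\<close>

lemma adj_op_twist:
  assumes "S \<subseteq> C" "c * c = 1" "\<And>h s. h \<in> H \<Longrightarrow> s \<in> S \<Longrightarrow> \<phi> (h \<otimes> s) = \<phi> h"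
    and y: "y \<in> carrier G"
  shows "adj_op G H S (twist c \<phi>) y = c * of_nat (card S) * twist c \<phi> y"
proof (cases "y \<in> H")
  case True
  have "twist c \<phi> (y \<otimes> s) = c * \<phi> y" if "s \<in> S" for s
    using mult_in_C[OF True, of s] assms(1) assms(3)[OF True that] that by (auto simp: twist_def)
  thus ?thesis
    using True by (simp add: adj_op_def twist_def)
next
  case False
  have "twist c \<phi> (y \<otimes> inv s) = \<phi> y" if s: "s \<in> S" for s
  proof -
    have h: "y \<otimes> inv s \<in> H"
      using mult_inv_in_H[of y s] y False s assms(1) by auto
    have "y \<otimes> inv s \<otimes> s = y"
      using y s assms(1) by (auto simp: m_assoc)
    thus ?thesis
      using h assms(3)[OF h s] by (simp add: twist_def)
  qed
  thus ?thesis
    using False assms(2) by (simp add: adj_op_def twist_def)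
qed

text \<open>Translation by any single \<open>s\<close> in \<open>S\<close> matches the two halves of
  \<open>W\<close>, so one constant can normalise both.\<close>

lemma closed_cards:
  assumes "S \<subseteq> C" "S \<noteq> {}" "\<And>h s. h \<in> H \<Longrightarrow> s \<in> S \<Longrightarrow> h \<otimes> s \<in> W \<longleftrightarrow> h \<in> W"
  shows "card (C \<inter> W) = card (H \<inter> W)"
proof -
  obtain s where s: "s \<in> S" using assms(2) by blast
  have bij: "bij_betw (\<lambda>h. h \<otimes> s) H C"
    using s assms(1) bij_betw_H_C by blast
  have "bij_betw (\<lambda>h. h \<otimes> s) (H \<inter> W) (C \<inter> W)"
  proof (rule bij_betw_subset[OF bij])
    have "C = (\<lambda>h. h \<otimes> s) ` H"
      using bij by (simp add: bij_betw_def)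
    thus "(\<lambda>h. h \<otimes> s) ` (H \<inter> W) = C \<inter> W"
      using assms(3)[OF _ s] by auto
  qed simp
  thus ?thesis
    by (metis bij_betw_same_card)
qed

text \<open>The witness is the indicator of \<open>W\<close> divided by the size of
  \<open>H \<inter> W\<close>, twisted by \<open>c\<close>. Its two sums do not depend on
  \<open>W\<close>, so they cancel in a difference of two such functions.\<close>

lemma closed_indicator:
  fixes c :: complex
  assumes "S \<subseteq> C" "S \<noteq> {}" "\<And>h s. h \<in> H \<Longrightarrow> s \<in> S \<Longrightarrow> h \<otimes> s \<in> W \<longleftrightarrow> h \<in> W"
    and "c * c = 1" "carrier G \<inter> W \<noteq> {}"
  obtains f where "eigenfunction G H S (c * of_nat (card S)) f"
    "\<And>x. x \<in> carrier G \<Longrightarrow> f x \<noteq> 0 \<longleftrightarrow> x \<in> W"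
    "(\<Sum>x\<in>H. f x) = 1" "(\<Sum>x\<in>C. f x) = c"
proof -
  let ?a = "of_nat (card (H \<inter> W)) :: complex"
  let ?f = "twist c (\<lambda>x. if x \<in> W then 1 / ?a else 0)"
  note cards = closed_cards[OF assms(1-3)]
  \<comment> \<open>The normalising division is legitimate: a \<open>W\<close> missing
    \<open>H\<close> would also miss \<open>C\<close>, hence the whole carrier.\<close>
  have "card (H \<inter> W) \<noteq> 0"
  proof
    assume "card (H \<inter> W) = 0"
    hence "H \<inter> W = {}" "C \<inter> W = {}"
      using cards finite_H finite_C by auto
    thus False using assms(5) by blast
  qed
  hence a: "?a \<noteq> 0" by simp
  have c: "c \<noteq> 0" using assms(4) by auto
  have supp: "?f x \<noteq> 0 \<longleftrightarrow> x \<in> W" for x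
    using a c by (simp add: twist_def)
  have "eigenfunction G H S (c * of_nat (card S)) ?f"
    unfolding eigenfunction_def
    using adj_op_twist[OF assms(1,4), of "\<lambda>x. if x \<in> W then 1 / ?a else 0"] assms(3,5) supp
    by auto
  moreover have "(\<Sum>x\<in>H. ?f x) = (\<Sum>x\<in>H \<inter> W. 1 / ?a)"
    unfolding sum.inter_restrict[OF finite_H] by (intro sum.cong) (auto simp: twist_def)
  moreover have "(\<Sum>x\<in>C. ?f x) = (\<Sum>x\<in>C \<inter> W. c / ?a)"
    unfolding sum.inter_restrict[OF finite_C] by (intro sum.cong) (auto simp: twist_def)
  ultimately show ?thesis
    using that[of ?f] supp a cards by simp
qed

text \<open>\<open>W\<close> consists of the vertices reachable from some \<open>u\<close> that
  fails to reach some \<open>v\<close>.\<close>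

lemma disconnected_closed_set:
  assumes "S \<subseteq> C" "\<not> Digraph_Component.connected (with_proj (pair_graph_of G H S))"
  obtains W where "carrier G \<inter> W \<noteq> {}" "carrier G - W \<noteq> {}"
    "\<And>h s. h \<in> H \<Longrightarrow> s \<in> S \<Longrightarrow> h \<otimes> s \<in> W \<longleftrightarrow> h \<in> W"
proof -
  \<comment> \<open>Connectedness is by definition strong connectedness of this symmetric
    closure.\<close>
  let ?M = "mk_symmetric (with_proj (pair_graph_of G H S))"
  have verts: "pverts ?M = carrier G"
    by (simp add: pair_graph_of_def)
  have arcs: "(h, h \<otimes> s) \<in> parcs ?M" "(h \<otimes> s, h) \<in> parcs ?M" if "h \<in> H" "s \<in> S" for h s
    using that by (force simp: parcs_mk_symmetric pair_graph_of_def)+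
  \<comment> \<open>Strong connectedness also demands a vertex; with that settled, its failure must
    be a missing path.\<close>
  have "carrier G \<noteq> {}" by auto
  then obtain u v where uv: "u \<in> carrier G" "v \<in> carrier G" "\<not> u \<rightarrow>\<^sup>*\<^bsub>?M\<^esub> v"
    using assms(2) verts by (auto simp: Digraph_Component.connected_def strongly_connected_def)
  show thesis
  proof (rule that[of "{x. u \<rightarrow>\<^sup>*\<^bsub>?M\<^esub> x}"])
    have "u \<rightarrow>\<^sup>*\<^bsub>?M\<^esub> u"
      using uv(1) verts by (simp add: reachable_def)
    thus "carrier G \<inter> {x. u \<rightarrow>\<^sup>*\<^bsub>?M\<^esub> x} \<noteq> {}"
      using uv(1) by blast
    show "carrier G - {x. u \<rightarrow>\<^sup>*\<^bsub>?M\<^esub> x} \<noteq> {}"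
      using uv by blast
    fix h s assume hs: "h \<in> H" "s \<in> S"
    hence "h \<in> carrier G" "h \<otimes> s \<in> carrier G"
      using assms(1) mem_carrier by auto
    \<comment> \<open>A path to either end of the edge extends to the other end, as both arcs are
      present.\<close>
    thus "h \<otimes> s \<in> {x. u \<rightarrow>\<^sup>*\<^bsub>?M\<^esub> x} \<longleftrightarrow> h \<in> {x. u \<rightarrow>\<^sup>*\<^bsub>?M\<^esub> x}"
      using arcs[OF hs] verts unfolding reachable_def
      by (auto intro: rtrancl_on_into_rtrancl_on)
  qed
qed

lemma disconnected_eigenfunctions:
  fixes c :: complex
  assumes "S1 \<subseteq> C" "S2 \<subseteq> C" "S1 \<union> S2 = C" "S1 \<inter> S2 = {}" "S1 \<noteq> {}" "c * c = 1"
    and "\<not> Digraph_Component.connected (with_proj (pair_graph_of G H S1))"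
    and \<mu>: "\<mu> = c * of_nat (card S1)"
  shows "\<exists>f g. eigenfunction G H S1 \<mu> f \<and> eigenfunction G H S1 \<mu> g \<and>
    lin_indep_pair_on (carrier G) f g \<and> eigenfunction G H S2 (- \<mu>) (\<lambda>x. f x - g x)"
proof -
  obtain W where W: "carrier G \<inter> W \<noteq> {}" "carrier G - W \<noteq> {}"
    and cl: "\<And>h s. h \<in> H \<Longrightarrow> s \<in> S1 \<Longrightarrow> h \<otimes> s \<in> W \<longleftrightarrow> h \<in> W"
    using disconnected_closed_set[OF assms(1,7)] by blast
  obtain f where f: "eigenfunction G H S1 \<mu> f" "\<And>x. x \<in> carrier G \<Longrightarrow> f x \<noteq> 0 \<longleftrightarrow> x \<in> W"
    "(\<Sum>x\<in>H. f x) = 1" "(\<Sum>x\<in>C. f x) = c"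
    using closed_indicator[OF assms(1,5) cl assms(6) W(1)] \<mu> by blast
  \<comment> \<open>Being closed along edges passes to the complement, so the same construction
    yields \<open>g\<close>.\<close>
  have "carrier G \<inter> - W \<noteq> {}" and "\<And>h s. h \<in> H \<Longrightarrow> s \<in> S1 \<Longrightarrow> h \<otimes> s \<in> - W \<longleftrightarrow> h \<in> - W"
    using W(2) cl by auto
  then obtain g where g: "eigenfunction G H S1 \<mu> g"
    "\<And>x. x \<in> carrier G \<Longrightarrow> g x \<noteq> 0 \<longleftrightarrow> x \<in> - W"
    "(\<Sum>x\<in>H. g x) = 1" "(\<Sum>x\<in>C. g x) = c"
    using closed_indicator[OF assms(1,5) _ assms(6), of "- W"] \<mu> by blast
  have indep: "lin_indep_pair_on (carrier G) f g"
    by (rule lin_indep_pair_on_disjoint_support[OF f(2) g(2) W])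
  have "eigenfunction G H S2 (- \<mu>) (\<lambda>x. f x - g x)"
    by (rule eigenfunction_complement[OF assms(1-4) eigenfunction_diff[OF f(1) g(1) indep]])
      (simp_all add: sum_subtractf f(3,4) g(3,4))
  with f(1) g(1) indep show ?thesis by blast
qed

end

theorem theorem4p5:
  fixes G :: "('a, 'm) monoid_scheme" and H S1 S2 :: "'a set" and n k :: nat
  assumes "group G" and "finite (carrier G)"
    and "subgroup H G" and "card (rcosets\<^bsub>G\<^esub> H) = 2" and "card H = n"
    and "S1 \<subseteq> carrier G - H" and "S2 \<subseteq> carrier G - H"
    and "S1 \<union> S2 = carrier G - H" and "S1 \<inter> S2 = {}"
    and "card S1 = k" and "card S2 = n - k" and "0 < k" and "k < n"
  shows
    "(\<not> Digraph_Component.connected (with_proj (pair_graph_of G H S1)) \<longrightarrow>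
       (\<forall>\<mu> \<in> {of_nat k, - of_nat k}.
          \<exists>f g. eigenfunction G H S1 \<mu> f \<and> eigenfunction G H S1 \<mu> g \<and>
            lin_indep_pair_on (carrier G) f g \<and>
            eigenfunction G H S2 (- \<mu>) (\<lambda>x. f x - g x)))
     \<and> (\<forall>\<mu> f. eigenfunction G H S1 \<mu> f \<and> \<mu> \<noteq> of_nat k \<and> \<mu> \<noteq> - of_nat k \<longrightarrow>
          eigenfunction G H S2 (- \<mu>) f)"
proof -
  interpret group G by fact
  interpret subgroup H G by fact
  interpret index_two G H
    by unfold_locales fact+
  have S1: "S1 \<noteq> {}"
    using \<open>card S1 = k\<close> \<open>0 < k\<close> by auto
  note parts = \<open>S1 \<subseteq> carrier G - H\<close> \<open>S2 \<subseteq> carrier G - H\<close> \<open>S1 \<union> S2 = carrier G - H\<close> \<open>S1 \<inter> S2 = {}\<close>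
  show ?thesis
  proof (intro conjI impI ballI allI)
    fix \<mu> :: complex
    assume "\<not> Digraph_Component.connected (with_proj (pair_graph_of G H S1))"
      and "\<mu> \<in> {of_nat k, - of_nat k}"
    \<comment> \<open>\<open>c\<close> is the sign of the eigenvalue, \<open>1\<close> or
      \<open>- 1\<close>.\<close>
    moreover from this obtain c :: complex where "c * c = 1" "\<mu> = c * of_nat (card S1)"
      using \<open>card S1 = k\<close> that[of 1] that[of "- 1"] by auto
    ultimately show "\<exists>f g. eigenfunction G H S1 \<mu> f \<and> eigenfunction G H S1 \<mu> g \<and>
        lin_indep_pair_on (carrier G) f g \<and> eigenfunction G H S2 (- \<mu>) (\<lambda>x. f x - g x)"
      using disconnected_eigenfunctions[OF parts S1] by blast
  next
    fix \<mu> :: complex and f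
    assume "eigenfunction G H S1 \<mu> f \<and> \<mu> \<noteq> of_nat k \<and> \<mu> \<noteq> - of_nat k"
    hence eig: "eigenfunction G H S1 \<mu> f" "0 < card S1" "\<mu> \<noteq> of_nat (card S1)" "\<mu> \<noteq> - of_nat (card S1)"
      using \<open>card S1 = k\<close> \<open>0 < k\<close> by auto
    show "eigenfunction G H S2 (- \<mu>) f"
      by (rule eigenfunction_complement[OF parts eig(1) eigenfunction_sums_zero[OF parts(1) eig]])
  qed
qed

end
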